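(* Let $d\ge1$ and $p,q\ge0$ be integers. Then $F(z)=z^p\overline{z}^q-b_{p,q}(\mathbb{C}^d)$ gives a potential for $\operatorname{Hom}_{p,q}(\mathbb{C}^d)$, and for $m\ge1$, $F(z)=(z+\overline z)^m-2^mb_m(\mathbb{R}^{2d})=2^m\{(\operatorname{Re}z)^m-b_m(\mathbb{R}^{2d})\}$ gives a potential for $\operatorname{Hom}_m(\mathbb{C}^d)$. Here "$F$ gives a potential for $P$" means: for all unit vectors $v_1,\ldots,v_n\in\mathbb{C}^d$ and all real weights $w_1+\cdots+w_n=1$, $$\sum_{j=1}^n\sum_{k=1}^nw_jw_kF(\langle v_j,v_k\rangle)\ge0,$$ with equality if and only if $\int_{\mathbb{S}}f\,d\sigma=\sum_jw_jf(v_j)$ for all $f\in P$.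
   Context: $\langle z,w\rangle=\sum_iz_i\overline{w_i}$ on $\mathbb{C}^d$; $\mathbb{S}$ is the unit sphere of $\mathbb{C}^d$ with normalised surface measure $\sigma$. $\operatorname{Hom}_{p,q}(\mathbb{C}^d)$ is the space of polynomials on $\mathbb{C}^d$ that are homogeneous of degree $p$ in $z_1,\ldots,z_d$ and of degree $q$ in $\overline{z_1},\ldots,\overline{z_d}$; $\operatorname{Hom}_m(\mathbb{C}^d)$ is the space of homogeneous polynomials of degree $m$ in the real coordinates of $\mathbb{C}^d=\mathbb{R}^{2d}$. $b_{p,q}(\mathbb{C}^d)=\int_{\mathbb{S}}\int_{\mathbb{S}}\langle z,w\rangle^p\overline{\langle z,w\rangle}^q d\sigma(z)d\sigma(w)$, which is $0$ if $p\ne q$ and $\frac{(d-1)!p!}{(d-1+p)!}$ if $p=q$. $b_m(\mathbb{R}^{2d})$ is $0$ for $m$ odd and $\frac{1\cdot3\cdots(m-1)}{2d(2d+2)\cdots(2d+m-2)}$ for $m$ even. *)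

theory Defs
  imports "HOL-Analysis.Analysis"
begin

text \<open>Points of C^d are modelled as vectors of type complex^'d, with 'd a finite index
type (so d = CARD('d) \<ge> 1). The norm on this type is the Euclidean norm.\<close>

definition cinner :: "complex^'d \<Rightarrow> complex^'d \<Rightarrow> complex" where
  "cinner z w = (\<Sum>i\<in>UNIV. z$i * cnj (w$i))"

text \<open>Integral over the unit sphere S with respect to the normalised surface measure sigma,
via the cone-measure description: integral over S of f dsigma equals the average over the
unit ball B of f(x/|x|).\<close>

definition sphere_integral :: "(complex^'d \<Rightarrow> complex) \<Rightarrow> complex" where
  "sphere_integral f =
     integral (ball 0 1) (\<lambda>x. f (scaleR (1 / norm x) x)) / complex_of_real (measure lborel (ball (0::complex^'d) 1))"

definition Hom_pq :: "nat \<Rightarrow> nat \<Rightarrow> (complex^'d \<Rightarrow> complex) set" where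
  "Hom_pq p q = {f. \<exists>c :: ('d \<Rightarrow> nat) \<Rightarrow> ('d \<Rightarrow> nat) \<Rightarrow> complex. \<forall>z.
     f z = (\<Sum>\<alpha>\<in>{\<alpha>. sum \<alpha> UNIV = p}. \<Sum>\<beta>\<in>{\<beta>. sum \<beta> UNIV = q}.
              c \<alpha> \<beta> * (\<Prod>i\<in>UNIV. (z$i) ^ (\<alpha> i) * (cnj (z$i)) ^ (\<beta> i)))}"

definition Hom_m :: "nat \<Rightarrow> (complex^'d \<Rightarrow> complex) set" where
  "Hom_m m = {f. \<exists>c :: ('d \<Rightarrow> nat) \<Rightarrow> ('d \<Rightarrow> nat) \<Rightarrow> complex. \<forall>z.
     f z = (\<Sum>\<alpha>\<beta>\<in>{(\<alpha>, \<beta>). sum \<alpha> UNIV + sum \<beta> UNIV = m}.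
              c (fst \<alpha>\<beta>) (snd \<alpha>\<beta>) *
              (\<Prod>i\<in>UNIV. complex_of_real ((Re (z$i)) ^ (fst \<alpha>\<beta> i) * (Im (z$i)) ^ (snd \<alpha>\<beta> i))))}"

text \<open>The constants b_{p,q}(C^d) and b_m(R^{2d}), with d the complex dimension.\<close>

definition b_pq :: "nat \<Rightarrow> nat \<Rightarrow> nat \<Rightarrow> real" where
  "b_pq d p q = (if p \<noteq> q then 0
                 else real (fact (d - 1) * fact p) / real (fact (d - 1 + p)))"

definition b_m :: "nat \<Rightarrow> nat \<Rightarrow> real" where
  "b_m d m = (if odd m then 0
              else (\<Prod>i<m div 2. real (2 * i + 1)) / (\<Prod>i<m div 2. real (2 * d + 2 * i)))"

definition gives_potential :: "(complex \<Rightarrow> complex) \<Rightarrow> (complex^'d \<Rightarrow> complex) set \<Rightarrow> bool" where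
  "gives_potential F P \<longleftrightarrow>
     (\<forall>(n::nat) (v :: nat \<Rightarrow> complex^'d) (w :: nat \<Rightarrow> real).
        (\<forall>j<n. norm (v j) = 1) \<and> (\<Sum>j<n. w j) = 1 \<longrightarrow>
        (let S = (\<Sum>j<n. \<Sum>k<n. complex_of_real (w j * w k) * F (cinner (v j) (v k))) in
          S \<in> \<real> \<and> Re S \<ge> 0 \<and>
          (S = 0 \<longleftrightarrow> (\<forall>f\<in>P. sphere_integral f = (\<Sum>j<n. complex_of_real (w j) * f (v j))))))"

end

theory Submission
  imports Defs
begin

text \<open>The powers of the inner product have a kernel expansion
  \<open>K(z, w) = \<lambda> (\<Sum>j. m j z * cnj (m j w))\<close> with \<open>\<lambda> > 0\<close>, where \<open>m j\<close> runs over the products of coordinates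
  (with repetitions) and these span the polynomial space. By unitary invariance the mean of \<open>K(z, w)\<close>
  over \<open>z\<close> in the sphere is the same constant for all unit vectors \<open>w\<close>, so subtracting this constant
  turns the double sum into \<open>\<lambda>\<close> times the sum of the squared cubature errors of the \<open>m j\<close>. The constant for
  \<open>|\<langle>z, w\<rangle>| ^ (2 * p)\<close> follows from the recursion \<open>p C(p - 1) = (p + d - 1) C(p)\<close>, and the
  constant for \<open>Re \<langle>z, w\<rangle> ^ m\<close> from it by the binomial theorem.\<close>

subsection \<open>The normalised sphere integral\<close>

lemma distr_lborel_plus: "distr lborel borel ((+) (c::'a::euclidean_space)) = lborel"
  by (subst lborel_affine[of 1 c]) (auto simp: density_1)

lemma nn_integral_lborel_shift:
  fixes g :: "'a::euclidean_space \<Rightarrow> ennreal"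
  assumes [measurable]: "g \<in> borel_measurable borel"
  shows "(\<integral>\<^sup>+y. g (c + y) \<partial>lborel) = (\<integral>\<^sup>+y. g y \<partial>lborel)"
proof -
  have "(\<integral>\<^sup>+y. g y \<partial>lborel) = (\<integral>\<^sup>+y. g y \<partial>distr lborel borel ((+) c))"
    by (simp only: distr_lborel_plus)
  also have "\<dots> = (\<integral>\<^sup>+y. g (c + y) \<partial>lborel)"
    by (rule nn_integral_distr) auto
  finally show ?thesis by simp
qed

text \<open>For \<open>A\<close> Borel and \<open>B\<close> the unit ball, integrate \<open>indicator A (U x) * indicator B (y - U x)\<close>
  over \<open>x\<close> and \<open>y\<close> in both orders: translation invariance gives \<open>|U\<^sup>-\<^sup>1 A| |B| = |A| |B|\<close>.\<close>

lemma distr_lborel_orthogonal: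
  fixes U :: "'a::euclidean_space \<Rightarrow> 'a"
  assumes U: "orthogonal_transformation U"
  shows "distr lborel borel U = lborel"
proof (rule measure_eqI)
  show "sets (distr lborel borel U) = sets lborel" by simp
next
  fix A :: "'a set"
  assume "A \<in> sets (distr lborel borel U)"
  then have [measurable]: "A \<in> sets borel" by simp
  have lin: "linear U" using U by (simp add: orthogonal_transformation_linear)
  have contU: "continuous_on UNIV U" by (simp add: lin linear_continuous_on linear_conv_bounded_linear[symmetric])
  have [measurable]: "U \<in> borel_measurable borel"
    using contU by (rule borel_measurable_continuous_onI)
  define B where "B = ball (0::'a) 1"
  have [measurable]: "B \<in> sets borel" by (simp add: B_def)
  have surj: "\<exists>x. U x = y" for y
    using orthogonal_transformation_surj[OF U] by (metis surjD)
  let ?A = "\<lambda>x. indicator A x :: ennreal"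
  let ?B = "\<lambda>x. indicator B x :: ennreal"
  let ?g = "\<lambda>x y. ?A (U x) * ?B (y - U x)"
  have "(\<integral>\<^sup>+x. ?A (U x) \<partial>lborel) * emeasure lborel B = (\<integral>\<^sup>+x. (\<integral>\<^sup>+y. ?g x y \<partial>lborel) \<partial>lborel)"
  proof -
    have "(\<integral>\<^sup>+y. ?g x y \<partial>lborel) = ?A (U x) * emeasure lborel B" for x
      using nn_integral_lborel_shift[of ?B "- U x"] by (simp add: nn_integral_cmult)
    then show ?thesis by (simp add: nn_integral_multc)
  qed
  also have "\<dots> = (\<integral>\<^sup>+y. (\<integral>\<^sup>+x. ?g x y \<partial>lborel) \<partial>lborel)"
    by (rule lborel_pair.Fubini') measurable
  also have "\<dots> = (\<integral>\<^sup>+y. (\<integral>\<^sup>+x. ?A (y + U x) * ?B (- U x) \<partial>lborel) \<partial>lborel)"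
  proof (rule nn_integral_cong)
    fix y :: 'a
    obtain c where c: "U c = y" using surj by blast
    have *: "U (c + x) = y + U x" for x
      by (simp add: c linear_add[OF lin])
    have "(\<integral>\<^sup>+x. ?g x y \<partial>lborel) = (\<integral>\<^sup>+x. ?g (c + x) y \<partial>lborel)"
      by (rule nn_integral_lborel_shift[symmetric]) measurable
    then show "(\<integral>\<^sup>+x. ?g x y \<partial>lborel) = (\<integral>\<^sup>+x. ?A (y + U x) * ?B (- U x) \<partial>lborel)"
      by (simp add: *)
  qed
  also have "\<dots> = (\<integral>\<^sup>+x. (\<integral>\<^sup>+y. ?A (y + U x) * ?B (- U x) \<partial>lborel) \<partial>lborel)"
    by (rule lborel_pair.Fubini') measurable
  also have "\<dots> = (\<integral>\<^sup>+x. emeasure lborel A * ?B x \<partial>lborel)"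
  proof (rule nn_integral_cong)
    fix x :: 'a
    have "?B (- U x) = ?B x"
      using U by (simp add: B_def indicator_def orthogonal_transformation)
    then show "(\<integral>\<^sup>+y. ?A (y + U x) * ?B (- U x) \<partial>lborel) = emeasure lborel A * ?B x"
      using nn_integral_lborel_shift[of ?A "U x"] by (simp add: nn_integral_multc add.commute)
  qed
  also have "\<dots> = emeasure lborel A * emeasure lborel B"
    by (simp add: nn_integral_cmult)
  finally have eq: "(\<integral>\<^sup>+x. ?A (U x) \<partial>lborel) * emeasure lborel B = emeasure lborel A * emeasure lborel B" .
  have "emeasure lborel B \<noteq> \<infinity>" "emeasure lborel B \<noteq> 0"
    using emeasure_lborel_ball_finite[of "0::'a" 1] content_ball_pos[of 1 "0::'a"]
    by (auto simp: B_def measure_def)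
  with eq have "(\<integral>\<^sup>+x. ?A (U x) \<partial>lborel) = emeasure lborel A"
    by (simp add: mult.commute[of _ "emeasure lborel B"] ennreal_mult_cancel_left)
  moreover have "emeasure (distr lborel borel U) A = (\<integral>\<^sup>+x. ?A (U x) \<partial>lborel)"
    by (subst nn_integral_distr[of U lborel borel ?A, symmetric]) auto
  ultimately show "emeasure (distr lborel borel U) A = emeasure lborel A" by simp
qed

text \<open>Radial projection keeps the argument in the closed unit ball, a compact set on which
  \<open>f\<close> is bounded, and the domain of integration has finite measure.\<close>

lemma sphere_integrable:
  fixes f :: "complex^'d \<Rightarrow> complex"
  assumes f: "continuous_on UNIV f"
  shows "set_integrable lborel (ball 0 1) (\<lambda>x. f (x /\<^sub>R norm x))"
proof -
  have [measurable]: "f \<in> borel_measurable borel"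
    using f by (rule borel_measurable_continuous_onI)
  have "compact (f ` cball 0 1)"
    using f by (intro compact_continuous_image) (auto intro: continuous_on_subset)
  then obtain C where C: "norm (f y) \<le> C" if "y \<in> cball 0 1" for y
    by (meson bounded_iff compact_imp_bounded imageI)
  \<comment> \<open>At the origin the integrand is \<open>f 0\<close>, since
    \<open>inverse 0 = 0\<close>; hence the bound over the closed ball and not only over the
    sphere.\<close>
  have bound: "norm (f (x /\<^sub>R norm x)) \<le> C" for x
    by (rule C) (cases "x = 0"; simp)
  show ?thesis
    unfolding set_integrable_def
  proof (rule integrableI_bounded_set_indicator)
    show "emeasure lborel (ball (0::complex^'d) 1) < \<infinity>"
      by (rule emeasure_lborel_ball_finite)
    show "AE x in lborel. x \<in> ball 0 1 \<longrightarrow> norm (f (x /\<^sub>R norm x)) \<le> C"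
      using bound by simp
  qed measurable
qed

text \<open>Passes from the gauge integral of the definition to the Lebesgue integral, where
  linearity and change of variables are applied.\<close>

lemma sphere_integral_lborel:
  fixes f :: "complex^'d \<Rightarrow> complex"
  assumes "continuous_on UNIV f"
  shows "sphere_integral f = (LINT x:ball 0 1|lborel. f (x /\<^sub>R norm x)) /
     complex_of_real (measure lborel (ball (0::complex^'d) 1))"
  using set_borel_integral_eq_integral(2)[OF sphere_integrable[OF assms]]
  by (simp add: sphere_integral_def inverse_eq_divide)

lemma sphere_integral_cong:
  fixes f g :: "complex^'d \<Rightarrow> complex"
  assumes "\<And>x. norm x = 1 \<Longrightarrow> f x = g x"
  shows "sphere_integral f = sphere_integral g"
proof -
  have "integral (ball 0 1) (\<lambda>x. f (scaleR (1 / norm x) x)) = integral (ball 0 1) (\<lambda>x. g (scaleR (1 / norm x) x))"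
    \<comment> \<open>The origin is the only point of the ball not projected to the sphere, and it
      is a null set.\<close>
    by (rule integral_spike[of "{0}"]) (auto intro!: assms[symmetric])
  then show ?thesis by (simp add: sphere_integral_def)
qed

lemma sphere_integral_const: "sphere_integral (\<lambda>x::complex^'d. c) = c"
  using content_ball_pos[of 1 "0::complex^'d"]
  by (subst sphere_integral_lborel)
     (auto simp: set_lebesgue_integral_def scaleR_conv_of_real)

lemma sphere_integral_add:
  fixes f g :: "complex^'d \<Rightarrow> complex"
  assumes "continuous_on UNIV f" "continuous_on UNIV g"
  shows "sphere_integral (\<lambda>x. f x + g x) = sphere_integral f + sphere_integral g"
  using assms
  by (simp add: sphere_integral_lborel sphere_integrable continuous_on_add add_divide_distrib)

lemma sphere_integral_cmult:
  fixes f :: "complex^'d \<Rightarrow> complex"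
  assumes "continuous_on UNIV f"
  shows "sphere_integral (\<lambda>x. c * f x) = c * sphere_integral f"
  using assms
  by (simp add: sphere_integral_lborel continuous_on_mult)

lemma sphere_integral_sum:
  fixes f :: "'a \<Rightarrow> complex^'d \<Rightarrow> complex"
  assumes "finite A" "\<And>a. a \<in> A \<Longrightarrow> continuous_on UNIV (f a)"
  shows "sphere_integral (\<lambda>x. \<Sum>a\<in>A. c a * f a x) = (\<Sum>a\<in>A. c a * sphere_integral (f a))"
  using assms
proof (induction A)
  case (insert a A)
  then show ?case
    by (simp add: sphere_integral_add sphere_integral_cmult continuous_on_mult continuous_on_sum)
qed (simp add: sphere_integral_const)

lemma sphere_integral_cnj:
  fixes f :: "complex^'d \<Rightarrow> complex"
  assumes "continuous_on UNIV f"
  shows "sphere_integral (\<lambda>x. cnj (f x)) = cnj (sphere_integral f)"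
proof -
  have "integral (ball 0 1) (\<lambda>x. cnj (f (scaleR (1 / norm x) x))) = cnj (integral (ball 0 1) (\<lambda>x. f (scaleR (1 / norm x) x)))"
    by (rule integral_cnj[symmetric])
  then show ?thesis by (simp add: sphere_integral_def)
qed

text \<open>\<open>U\<close> preserves Lebesgue measure and the unit ball and, being linear and
  isometric, commutes with radial projection.\<close>

lemma sphere_integral_orthogonal:
  fixes f :: "complex^'d \<Rightarrow> complex" and U :: "complex^'d \<Rightarrow> complex^'d"
  assumes f: "continuous_on UNIV f" and U: "orthogonal_transformation U"
  shows "sphere_integral (\<lambda>x. f (U x)) = sphere_integral f"
proof -
  have lin: "linear U" using U by (simp add: orthogonal_transformation_linear)
  have contU: "continuous_on UNIV U" by (simp add: lin linear_continuous_on linear_conv_bounded_linear[symmetric])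
  have [measurable]: "U \<in> borel_measurable borel"
    using contU by (rule borel_measurable_continuous_onI)
  have [measurable]: "f \<in> borel_measurable borel"
    using f by (rule borel_measurable_continuous_onI)
  have norm: "norm (U x) = norm x" for x
    using U by (simp add: orthogonal_transformation)
  have "(LINT x:ball 0 1|lborel. f (x /\<^sub>R norm x)) = (LINT x:ball 0 1|distr lborel borel U. f (x /\<^sub>R norm x))"
    by (simp add: distr_lborel_orthogonal[OF U])
  also have "\<dots> = (LINT x:ball 0 1|lborel. f (U (x /\<^sub>R norm x)))"
    unfolding set_lebesgue_integral_def
    by (subst integral_distr) (auto simp: indicator_def norm linear_cmul[OF lin] linear_scale[OF lin])
  finally show ?thesis
    using f contU by (simp add: sphere_integral_lborel continuous_on_compose2[OF f])
qed

subsection \<open>Unitary invariance\<close>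

lemma cinner_self: "cinner z z = complex_of_real ((norm z)\<^sup>2)"
proof -
  have "complex_of_real ((norm z)\<^sup>2) = (\<Sum>i\<in>UNIV. complex_of_real ((norm (z$i))\<^sup>2))"
    by (simp add: norm_vec_def L2_set_def sum_nonneg)
  also have "\<dots> = cinner z z"
    by (simp only: cinner_def complex_norm_square)
  finally show ?thesis by simp
qed

lemma cinner_diff_left: "cinner (x - y) z = cinner x z - cinner y z"
  by (simp add: cinner_def sum_subtractf algebra_simps)

lemma cinner_diff_right: "cinner x (y - z) = cinner x y - cinner x z"
  by (simp add: cinner_def sum_subtractf algebra_simps)

lemma cinner_smult_left: "cinner (a *s x) z = a * cinner x z"
  by (simp add: cinner_def sum_distrib_left mult.assoc)

lemma cinner_smult_right: "cinner x (a *s z) = cnj a * cinner x z"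
  by (simp add: cinner_def sum_distrib_left mult_ac)

lemma cinner_commute: "cinner y x = cnj (cinner x y)"
  by (simp add: cinner_def mult.commute)

lemma cinner_axis: "cinner z (axis k 1) = z $ k"
  by (simp add: cinner_def axis_def if_distrib cong: if_cong)

lemma continuous_cinner [continuous_intros]:
  "continuous_on A f \<Longrightarrow> continuous_on A g \<Longrightarrow> continuous_on A (\<lambda>z. cinner (f z) (g z))"
  unfolding cinner_def by (intro continuous_intros)

lemma vec_smult_linear: "linear (\<lambda>z::complex^'d. \<chi> i. a i * z $ i)"
  by (rule linearI) (auto simp: vec_eq_iff algebra_simps)

lemma orthogonal_transformation_diagonal:
  assumes "\<And>i. norm (a i) = 1"
  shows "orthogonal_transformation (\<lambda>z::complex^'d. \<chi> i. a i * z $ i)"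
  by (simp add: orthogonal_transformation vec_smult_linear norm_vec_def norm_mult assms)

text \<open>The Hermitian Householder reflection in \<open>u\<close>; for \<open>u = 0\<close> the junk value \<open>x / 0 = 0\<close> makes it
  the identity.\<close>

definition reflection :: "complex^'d \<Rightarrow> complex^'d \<Rightarrow> complex^'d" where
  "reflection u z = z - (2 * cinner z u / cinner u u) *s u"

lemma norm_reflection: "norm (reflection u z) = norm z"
proof -
  define s where "s = cinner z u"
  define r where "r = (norm u)\<^sup>2"
  have uu: "cinner u u = complex_of_real r" by (simp add: r_def cinner_self)
  have us: "cinner u z = cnj s" by (simp add: s_def cinner_commute[of u z])
  have "cinner (reflection u z) (reflection u z) =
      cinner z z - 2 * cnj s / r * s - 2 * s / r * (cnj s - 2 * cnj s / r * r)"
    unfolding reflection_def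
    by (simp add: cinner_diff_left cinner_diff_right cinner_smult_left cinner_smult_right us uu
        flip: s_def)
  \<comment> \<open>The two cross terms together give \<open>-4 * |s|^2 / r\<close>, which the
    quadratic term cancels; for \<open>r = 0\<close> all quotients are 0.\<close>
  also have "\<dots> = cinner z z"
    by (cases "r = 0") (simp_all add: field_simps)
  finally have "(norm (reflection u z))\<^sup>2 = (norm z)\<^sup>2"
    unfolding cinner_self of_real_eq_iff .
  then show ?thesis by simp
qed

lemma orthogonal_transformation_reflection: "orthogonal_transformation (reflection u)"
proof -
  have "linear (reflection u)"
    by (rule linearI)
      (auto simp: reflection_def vec_eq_iff cinner_def sum.distrib sum_distrib_left algebra_simps
        add_divide_distrib sum_divide_distrib scaleR_right.sum scaleR_conv_of_real[where 'a = complex])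
  then show ?thesis by (simp add: orthogonal_transformation norm_reflection)
qed

text \<open>With \<open>u = w - w'\<close> and \<open>cinner w w'\<close> real,
  \<open>cinner u u = 2 * cinner u w\<close>, so the reflection subtracts exactly
  \<open>cinner z u\<close> from \<open>cinner z w\<close>.\<close>

lemma cinner_reflection:
  assumes "norm w = 1" "norm w' = 1" "cinner w w' \<in> \<real>"
  shows "cinner (reflection (w - w') z) w = cinner z w'"
proof -
  obtain \<rho> where \<rho>: "cinner w w' = complex_of_real \<rho>"
    using assms(3) by (auto elim: Reals_cases)
  have \<rho>': "cinner w' w = complex_of_real \<rho>"
    by (simp add: cinner_commute[of w' w] \<rho>)
  have ww: "cinner w w = 1" "cinner w' w' = 1"
    using assms by (simp_all add: cinner_self)
  have uu: "cinner (w - w') (w - w') = 2 * (1 - complex_of_real \<rho>)"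
    by (simp add: cinner_diff_left cinner_diff_right \<rho> \<rho>' ww)
  have uw: "cinner (w - w') w = 1 - complex_of_real \<rho>"
    by (simp add: cinner_diff_left \<rho>' ww)
  show ?thesis
  proof (cases "\<rho> = 1")
    case True
    then have "w = w'" using uu by (simp add: cinner_self)
    then show ?thesis by (simp add: reflection_def)
  next
    case False
    then have "1 - complex_of_real \<rho> \<noteq> 0" by auto
    then have "2 * cinner z (w - w') / (2 * (1 - complex_of_real \<rho>)) * (1 - complex_of_real \<rho>) = cinner z (w - w')"
      by (simp only: mult_divide_mult_cancel_left_if) simp
    then show ?thesis
      unfolding reflection_def cinner_diff_left[of z] cinner_smult_left uu uw
      by (simp add: cinner_diff_right)
  qed
qed

section \<open>Means that vanish by rotating coordinates\<close>

lemma ex_phase_neg1: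
  assumes "p \<noteq> q"
  obtains \<mu> where "norm \<mu> = 1" "\<mu> ^ p * cnj \<mu> ^ q = -1"
proof
  \<comment> \<open>The product has angle \<open>(p - q) * \<theta>\<close>, and this choice makes
    it \<open>pi\<close>. The difference is taken in the reals, where it may be negative.\<close>
  define \<theta> where "\<theta> = pi / (real p - real q)"
  have "cis \<theta> ^ p * cnj (cis \<theta>) ^ q = cis ((real p - real q) * \<theta>)"
    by (simp only: cis_cnj Complex.DeMoivre cis_mult) (rule arg_cong[of _ _ cis], simp add: algebra_simps)
  also have "(real p - real q) * \<theta> = pi"
    using assms by (simp add: \<theta>_def)
  finally show "cis \<theta> ^ p * cnj (cis \<theta>) ^ q = -1" by simp
qed simp

text \<open>A diagonal unitary change of variables preserves the mean, yet here it also flips its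
  sign.\<close>

lemma sphere_integral_eq_0:
  fixes f :: "complex^'d \<Rightarrow> complex"
  assumes f: "continuous_on UNIV f" and a: "\<And>i. norm (a i) = 1"
    and eq: "\<And>z. f (\<chi> i. a i * z $ i) = - f z"
  shows "sphere_integral f = 0"
proof -
  have "sphere_integral f = sphere_integral (\<lambda>z. f (\<chi> i. a i * z $ i))"
    by (intro sphere_integral_orthogonal[symmetric] f orthogonal_transformation_diagonal a)
  also have "\<dots> = - sphere_integral f"
    using sphere_integral_cmult[OF f, of "-1"] by (simp add: eq)
  finally show ?thesis by simp
qed

lemma sphere_integral_unequal_powers:
  fixes w :: "complex^'d"
  assumes "p \<noteq> q"
  shows "sphere_integral (\<lambda>z. cinner z w ^ p * cnj (cinner z w) ^ q) = 0"
proof -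
  obtain \<mu> where \<mu>: "norm \<mu> = 1" "\<mu> ^ p * cnj \<mu> ^ q = -1"
    using ex_phase_neg1[OF assms] .
  let ?f = "\<lambda>z::complex^'d. cinner z w ^ p * cnj (cinner z w) ^ q"
  have "?f (\<chi> i. \<mu> * z $ i) = - ?f z" for z
  proof -
    have "cinner (\<chi> i. \<mu> * z $ i) w = \<mu> * cinner z w"
      by (simp add: cinner_def sum_distrib_left mult.assoc)
    then have "?f (\<chi> i. \<mu> * z $ i) = (\<mu> ^ p * cnj \<mu> ^ q) * ?f z"
      by (simp add: power_mult_distrib)
    then show ?thesis unfolding \<mu> by simp
  qed
  then show ?thesis
    by (intro sphere_integral_eq_0[where a = "\<lambda>_. \<mu>"] continuous_intros) (simp_all add: \<mu>)
qed

text \<open>Only coordinate \<open>i\<close> is rotated; since \<open>k \<noteq> i\<close>, the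
  factor in \<open>z $ k\<close> stays fixed while the other changes sign.\<close>

lemma sphere_integral_monomial_unequal:
  fixes k i :: "'d::finite"
  assumes "k \<noteq> i" "a \<noteq> b"
  shows "sphere_integral (\<lambda>z::complex^'d. z $ i ^ a * cnj (z $ i) ^ b * (z $ k ^ c * cnj (z $ k) ^ e)) = 0"
proof -
  obtain \<mu> where \<mu>: "norm \<mu> = 1" "\<mu> ^ a * cnj \<mu> ^ b = -1"
    using ex_phase_neg1[OF assms(2)] .
  let ?f = "\<lambda>z::complex^'d. z $ i ^ a * cnj (z $ i) ^ b * (z $ k ^ c * cnj (z $ k) ^ e)"
  have "?f (\<chi> j. (if j = i then \<mu> else 1) * z $ j) = - ?f z" for z
  proof -
    have "?f (\<chi> j. (if j = i then \<mu> else 1) * z $ j) = (\<mu> ^ a * cnj \<mu> ^ b) * ?f z"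
      using assms by (simp add: power_mult_distrib)
    then show ?thesis unfolding \<mu> by simp
  qed
  then show ?thesis
    by (intro sphere_integral_eq_0[where a = "\<lambda>j. if j = i then \<mu> else 1"] continuous_intros)
       (simp_all add: \<mu>)
qed

text \<open>A phase on \<open>w'\<close> does not affect the modulus of \<open>cinner z w'\<close>
  and can make \<open>cinner w w'\<close> real; a reflection then carries one integrand to the
  other.\<close>

lemma sphere_integral_power_unit:
  fixes w w' :: "complex^'d"
  assumes "norm w = 1" "norm w' = 1"
  shows "sphere_integral (\<lambda>z. cinner z w ^ p * cnj (cinner z w) ^ p) =
         sphere_integral (\<lambda>z. cinner z w' ^ p * cnj (cinner z w') ^ p)"
proof -
  \<comment> \<open>If \<open>cinner w w' = 0\<close>, its \<open>sgn\<close> is 0 and not a phase,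
    so 1 is taken instead.\<close>
  define \<mu> where "\<mu> = (if cinner w w' = 0 then 1 else sgn (cinner w w'))"
  have norm_\<mu>: "norm \<mu> = 1" by (simp add: \<mu>_def norm_sgn)
  have mm: "\<mu> * cnj \<mu> = 1" using norm_\<mu> by (simp add: complex_norm_square[symmetric])
  have real: "cinner w (\<mu> *s w') \<in> \<real>"
  proof (cases "cinner w w' = 0")
    case False
    have "cnj (sgn (cinner w w')) * cinner w w' = complex_of_real (norm (cinner w w'))"
      using False by (simp add: sgn_eq complex_norm_square[symmetric] power2_eq_square field_simps)
    then show ?thesis using False by (simp add: cinner_smult_right \<mu>_def)
  qed (simp add: cinner_smult_right)
  have norm': "norm (\<mu> *s w') = 1"
  proof -
    have "cinner (\<mu> *s w') (\<mu> *s w') = (\<mu> * cnj \<mu>) * cinner w' w'"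
      by (simp add: cinner_smult_left cinner_smult_right)
    then have "complex_of_real ((norm (\<mu> *s w'))\<^sup>2) = 1"
      unfolding mm cinner_self using assms by simp
    then show ?thesis unfolding of_real_eq_1_iff using norm_ge_zero[of "\<mu> *s w'"] by (auto simp: power2_eq_1_iff)
  qed
  let ?f = "\<lambda>z::complex^'d. cinner z w ^ p * cnj (cinner z w) ^ p"
  have "?f (reflection (w - \<mu> *s w') z) = cinner z w' ^ p * cnj (cinner z w') ^ p" for z
  proof -
    have "?f (reflection (w - \<mu> *s w') z) = (\<mu> * cnj \<mu>) ^ p * (cinner z w' ^ p * cnj (cinner z w') ^ p)"
      by (simp add: cinner_reflection[OF assms(1) norm' real] cinner_smult_right power_mult_distrib mult_ac)
    then show ?thesis by (simp add: mm)
  qed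
  moreover have "sphere_integral (\<lambda>z. ?f (reflection (w - \<mu> *s w') z)) = sphere_integral ?f"
    by (intro sphere_integral_orthogonal orthogonal_transformation_reflection continuous_intros)
  ultimately show ?thesis by simp
qed

subsection \<open>Means of powers of the inner product\<close>

lemma norm_axis_complex: "norm (axis k (1::complex)) = 1"
  by (simp add: norm_eq_sqrt_inner inner_axis_axis)

lemma cinner_axis_plus:
  "cinner z (axis k 1 + complex_of_real t *s axis i 1) = z $ k + complex_of_real t * z $ i"
  using cinner_diff_right[of z "axis k 1 + complex_of_real t *s axis i 1" "complex_of_real t *s axis i 1"]
  by (simp add: cinner_smult_right cinner_axis)

text \<open>Homogeneity reduces to a unit vector, which may be exchanged for a coordinate
  axis.\<close>

lemma sphere_integral_power:
  fixes w :: "complex^'d" and k :: 'd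
  shows "sphere_integral (\<lambda>z. cinner z w ^ p * cnj (cinner z w) ^ p) =
         complex_of_real (norm w ^ (2 * p)) * sphere_integral (\<lambda>z. z $ k ^ p * cnj (z $ k) ^ p)"
proof -
  obtain u :: "complex^'d" where u: "norm u = 1" "w = complex_of_real (norm w) *s u"
  proof (cases "w = 0")
    case True
    then show ?thesis using that[of "axis k 1"] by (simp add: norm_axis_complex)
  next
    case False
    have "complex_of_real (norm w) *s (inverse (norm w) *\<^sub>R w) = w"
      using False by (simp add: vec_eq_iff scaleR_conv_of_real[where 'a = complex])
    then show ?thesis using False that[of "inverse (norm w) *\<^sub>R w"] by simp
  qed
  have "cinner z w ^ p * cnj (cinner z w) ^ p =
      complex_of_real (norm w ^ (2 * p)) * (cinner z u ^ p * cnj (cinner z u) ^ p)" for z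
    by (subst (1 2) u(2)) (simp add: cinner_smult_right power_mult_distrib power_mult power2_eq_square)
  then have "sphere_integral (\<lambda>z. cinner z w ^ p * cnj (cinner z w) ^ p) =
      complex_of_real (norm w ^ (2 * p)) * sphere_integral (\<lambda>z. cinner z u ^ p * cnj (cinner z u) ^ p)"
    by (simp only:) (intro sphere_integral_cmult continuous_intros)
  also have "sphere_integral (\<lambda>z. cinner z u ^ p * cnj (cinner z u) ^ p) =
      sphere_integral (\<lambda>z. cinner z (axis k 1) ^ p * cnj (cinner z (axis k 1)) ^ p)"
    by (rule sphere_integral_power_unit) (auto simp: u norm_axis_complex)
  finally show ?thesis by (simp add: cinner_axis)
qed

text \<open>As a polynomial in the square of \<open>t\<close>, the sum vanishes at the squares of
  all natural numbers and so has infinitely many roots.\<close>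

lemma polyfun_even_eq_0:
  fixes c :: "nat \<Rightarrow> complex"
  assumes "\<And>t::real. (\<Sum>j\<le>n. c j * complex_of_real t ^ (2 * j)) = 0" "k \<le> n"
  shows "c k = 0"
proof (rule ccontr)
  assume "c k \<noteq> 0"
  then have "finite {z. (\<Sum>j\<le>n. c j * z ^ j) = 0}"
    using polyfun_rootbound_finite assms(2) by blast
  moreover have "range (\<lambda>m::nat. complex_of_real (real m ^ 2)) \<subseteq> {z. (\<Sum>j\<le>n. c j * z ^ j) = 0}"
  proof safe
    fix m :: nat
    show "(\<Sum>j\<le>n. c j * complex_of_real (real m ^ 2) ^ j) = 0"
      using assms(1)[of "real m"] by (simp add: power_mult)
  qed
  moreover have "inj (\<lambda>m::nat. complex_of_real (real m ^ 2))"
    by (rule injI) (simp del: of_real_power of_nat_power)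
  ultimately show False
    using finite_subset range_inj_infinite by blast
qed

text \<open>Compare the coefficients of \<open>t\<^sup>2\<close> in the mean of \<open>|z $ k + t * z $ i| ^ (2 * p)\<close>, which is
  proportional to \<open>(1 + t\<^sup>2) ^ p\<close>.\<close>

lemma sphere_integral_mixed:
  fixes k i :: "'d::finite"
  assumes "k \<noteq> i" "p \<ge> 1"
  shows "of_nat p * sphere_integral (\<lambda>z::complex^'d. z $ i * cnj (z $ i) * (z $ k ^ (p - 1) * cnj (z $ k) ^ (p - 1))) =
         sphere_integral (\<lambda>z::complex^'d. z $ k ^ p * cnj (z $ k) ^ p)"
proof -
  define C where "C = sphere_integral (\<lambda>z::complex^'d. z $ k ^ p * cnj (z $ k) ^ p)"
  define m where "m = (\<lambda>(a, b) (z::complex^'d). z $ i ^ a * cnj (z $ i) ^ b * (z $ k ^ (p - a) * cnj (z $ k) ^ (p - b)))"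
  have m: "continuous_on UNIV (m ab)" for ab
    unfolding m_def split_def by (intro continuous_intros)
  \<comment> \<open>One mean computed twice: on the left by expanding both factors binomially, on
    the right by \<open>sphere_integral_power\<close> with \<open>(1 + t^2) ^ p\<close>
    expanded.\<close>
  have expand: "(\<Sum>j\<le>p. (of_nat (p choose j))\<^sup>2 * sphere_integral (m (j, j)) * complex_of_real t ^ (2 * j)) =
      (\<Sum>j\<le>p. of_nat (p choose j) * C * complex_of_real t ^ (2 * j))" for t :: real
  proof -
    let ?w = "axis k 1 + complex_of_real t *s axis i 1 :: complex^'d"
    let ?t = "complex_of_real t"
    have "(norm ?w)\<^sup>2 = 1 + t\<^sup>2"
    proof -
      have "complex_of_real ((norm ?w)\<^sup>2) = complex_of_real (1 + t\<^sup>2)"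
        unfolding cinner_self[symmetric] cinner_axis_plus using assms(1)
        by (simp add: axis_def power2_eq_square)
      then show ?thesis unfolding of_real_eq_iff .
    qed
    then have norm: "complex_of_real (norm ?w ^ (2 * p)) = (\<Sum>j\<le>p. of_nat (p choose j) * ?t ^ (2 * j))"
      by (simp add: power_mult add.commute[of 1] binomial_ring)
    let ?c = "\<lambda>(a, b). of_nat (p choose a) * of_nat (p choose b) * ?t ^ (a + b)"
    have "cinner z ?w ^ p * cnj (cinner z ?w) ^ p = (\<Sum>ab\<in>{..p} \<times> {..p}. ?c ab * m ab z)" for z
    proof -
      have "(z $ k + ?t * z $ i) ^ p = (\<Sum>a\<le>p. of_nat (p choose a) * (?t * z $ i) ^ a * z $ k ^ (p - a))"
        by (subst add.commute) (rule binomial_ring)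
      moreover have "cnj (z $ k + ?t * z $ i) ^ p =
          (\<Sum>a\<le>p. of_nat (p choose a) * (?t * cnj (z $ i)) ^ a * cnj (z $ k) ^ (p - a))"
        by (subst add.commute) (simp add: binomial_ring)
      ultimately show ?thesis
        unfolding cinner_axis_plus
        by (simp add: sum_product sum.cartesian_product m_def power_mult_distrib power_add split_def mult_ac)
    qed
    then have "sphere_integral (\<lambda>z. cinner z ?w ^ p * cnj (cinner z ?w) ^ p) =
        (\<Sum>ab\<in>{..p} \<times> {..p}. ?c ab * sphere_integral (m ab))"
      by (simp only:) (intro sphere_integral_sum m; simp)
    also have "\<dots> = (\<Sum>a\<le>p. \<Sum>b\<le>p. ?c (a, b) * sphere_integral (m (a, b)))"
      by (simp add: sum.cartesian_product split_def)
    \<comment> \<open>Rotating coordinate \<open>i\<close> alone kills every term with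
      \<open>a \<noteq> b\<close>.\<close>
    also have "\<dots> = (\<Sum>a\<le>p. \<Sum>b\<le>p. if a = b then ?c (a, b) * sphere_integral (m (a, b)) else 0)"
      using sphere_integral_monomial_unequal[OF assms(1)]
      by (intro sum.cong refl) (auto simp: m_def)
    also have "\<dots> = (\<Sum>j\<le>p. (of_nat (p choose j))\<^sup>2 * sphere_integral (m (j, j)) * ?t ^ (2 * j))"
      by (simp add: power2_eq_square mult_ac flip: mult_2)
    finally have "complex_of_real (norm ?w ^ (2 * p)) * C =
       (\<Sum>j\<le>p. (of_nat (p choose j))\<^sup>2 * sphere_integral (m (j, j)) * ?t ^ (2 * j))"
      unfolding sphere_integral_power[of ?w p k] C_def .
    then show ?thesis
      unfolding norm by (simp add: sum_distrib_right sum_distrib_left mult_ac)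
  qed
  \<comment> \<open>At \<open>j = 1\<close> the coefficient \<open>p\<close> enters squared on one
    side and once on the other; one factor \<open>p\<close> then cancels because
    \<open>p \<ge> 1\<close>.\<close>
  have "(of_nat (p choose 1))\<^sup>2 * sphere_integral (m (1, 1)) - of_nat (p choose 1) * C = 0"
    by (rule polyfun_even_eq_0[where n = p and k = 1
          and c = "\<lambda>j. (of_nat (p choose j))\<^sup>2 * sphere_integral (m (j, j)) - of_nat (p choose j) * C"])
       (use expand assms(2) in \<open>simp_all add: left_diff_distrib sum_subtractf\<close>)
  then have "of_nat p * (of_nat p * sphere_integral (m (1, 1))) = of_nat p * C"
    by (simp add: power2_eq_square mult.assoc)
  then have "of_nat p * sphere_integral (m (1, 1)) = C"
    using assms(2) by simp
  then show ?thesis by (simp add: m_def C_def)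
qed

text \<open>On the sphere, 1 is the sum of the squared moduli of the coordinates. Inserted into the
  mean for exponent \<open>p - 1\<close>, the term of index \<open>k\<close> gives \<open>C\<close>,
  and each of the other \<open>CARD('d) - 1\<close> terms gives \<open>C / p\<close> by
  \<open>sphere_integral_mixed\<close>.\<close>

lemma sphere_integral_coordinate_rec:
  fixes k :: "'d::finite"
  assumes "p \<ge> 1"
  shows "of_nat p * sphere_integral (\<lambda>z::complex^'d. z $ k ^ (p - 1) * cnj (z $ k) ^ (p - 1)) =
         of_nat (p + CARD('d) - 1) * sphere_integral (\<lambda>z::complex^'d. z $ k ^ p * cnj (z $ k) ^ p)"
proof -
  define C where "C = sphere_integral (\<lambda>z::complex^'d. z $ k ^ p * cnj (z $ k) ^ p)"
  define g where "g = (\<lambda>i (z::complex^'d). z $ i * cnj (z $ i) * (z $ k ^ (p - 1) * cnj (z $ k) ^ (p - 1)))"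
  have g: "continuous_on UNIV (g i)" for i
    unfolding g_def by (intro continuous_intros)
  have "sphere_integral (\<lambda>z::complex^'d. z $ k ^ (p - 1) * cnj (z $ k) ^ (p - 1)) =
        sphere_integral (\<lambda>z. \<Sum>i\<in>UNIV. 1 * g i z)"
  proof (rule sphere_integral_cong)
    fix z :: "complex^'d"
    assume "norm z = 1"
    then have "cinner z z = 1" by (simp add: cinner_self)
    then show "z $ k ^ (p - 1) * cnj (z $ k) ^ (p - 1) = (\<Sum>i\<in>UNIV. 1 * g i z)"
      by (simp add: g_def cinner_def sum_distrib_right[symmetric])
  qed
  also have "\<dots> = (\<Sum>i\<in>UNIV. sphere_integral (g i))"
    using sphere_integral_sum[of UNIV g "\<lambda>_. 1"] g by simp
  also have "\<dots> = sphere_integral (g k) + (\<Sum>i\<in>UNIV - {k}. sphere_integral (g i))"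
    by (rule sum.remove) auto
  finally have eq: "of_nat p * sphere_integral (\<lambda>z::complex^'d. z $ k ^ (p - 1) * cnj (z $ k) ^ (p - 1)) =
      of_nat p * sphere_integral (g k) + (\<Sum>i\<in>UNIV - {k}. of_nat p * sphere_integral (g i))"
    by (simp add: distrib_left sum_distrib_left)
  have gk: "sphere_integral (g k) = C"
    using assms unfolding C_def g_def
    by (cases p) (simp_all add: mult_ac)
  have gi: "of_nat p * sphere_integral (g i) = C" if "i \<in> UNIV - {k}" for i
    using sphere_integral_mixed[of k i p] that assms by (simp add: g_def C_def)
  have "(\<Sum>i\<in>UNIV - {k}. of_nat p * sphere_integral (g i)) = of_nat (CARD('d) - 1) * C"
    by (simp add: gi)
  moreover have "p + CARD('d) - 1 = p + (CARD('d) - 1)"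
    using zero_less_card_finite[where 'a = 'd] by linarith
  ultimately show ?thesis
    unfolding eq gk C_def[symmetric] by (simp add: distrib_right del: One_nat_def)
qed

text \<open>Unequal exponents average out by rotation. For equal ones \<open>w\<close> is moved to a
  coordinate axis, and the quotient of factorials solves the recursion with value 1 at
  \<open>p = 0\<close>.\<close>

lemma sphere_integral_b_pq:
  fixes w :: "complex^'d"
  assumes "norm w = 1"
  shows "sphere_integral (\<lambda>z. cinner z w ^ p * cnj (cinner z w) ^ q) = complex_of_real (b_pq CARD('d) p q)"
proof (cases "p = q")
  case False
  then show ?thesis by (simp add: sphere_integral_unequal_powers b_pq_def)
next
  case True
  fix k :: 'd
  have "sphere_integral (\<lambda>z::complex^'d. z $ k ^ p * cnj (z $ k) ^ p) = complex_of_real (b_pq CARD('d) p p)"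
  proof (induction p)
    case 0
    then show ?case by (simp add: b_pq_def sphere_integral_const)
  next
    case (Suc p)
    define D where "D = CARD('d) - 1"
    have D: "CARD('d) = Suc D"
      using zero_less_card_finite[where 'a = 'd] by (simp add: D_def)
    have "of_nat (Suc p + D) * sphere_integral (\<lambda>z::complex^'d. z $ k ^ Suc p * cnj (z $ k) ^ Suc p) =
        of_nat (Suc p) * complex_of_real (b_pq CARD('d) p p)"
      using sphere_integral_coordinate_rec[of "Suc p" k] Suc by (simp add: D)
    also have "\<dots> = complex_of_real (real (Suc p) * b_pq (Suc D) p p)"
      by (simp add: D)
    also have "real (Suc p) * b_pq (Suc D) p p = real (Suc p + D) * b_pq (Suc D) (Suc p) (Suc p)"
      by (simp add: b_pq_def field_simps del: of_nat_Suc of_nat_add of_nat_mult) (simp add: algebra_simps)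
    finally have "of_nat (Suc p + D) * sphere_integral (\<lambda>z::complex^'d. z $ k ^ Suc p * cnj (z $ k) ^ Suc p) =
       of_nat (Suc p + D) * complex_of_real (b_pq CARD('d) (Suc p) (Suc p))"
      by (simp only: of_real_mult of_real_of_nat_eq D)
    then show ?case by (simp only: mult_cancel_left of_nat_eq_0_iff) simp
  qed
  then show ?thesis
    using True assms sphere_integral_power[of w p k] by simp
qed

section \<open>Factorial form of the constant for powers of the real part\<close>

lemma prod_odd: "(\<Prod>i<k. real (2 * i + 1)) * (2 ^ k * fact k) = fact (2 * k)"
proof (induction k)
  case (Suc k)
  \<comment> \<open>The factor \<open>2 ^ k * fact k\<close> is the product of the even numbers up
    to \<open>2 * k\<close> and completes the odd product to a factorial; this step adds
    \<open>2 * k + 1\<close> and \<open>2 * k + 2\<close>.\<close>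
  have "(\<Prod>i<Suc k. real (2 * i + 1)) * (2 ^ Suc k * fact (Suc k)) =
      (real (2 * k + 1) * (2 * real (k + 1))) * ((\<Prod>i<k. real (2 * i + 1)) * (2 ^ k * fact k))"
    by (simp only: prod.lessThan_Suc power_Suc fact_Suc of_nat_Suc) (simp add: mult_ac)
  also have "\<dots> = fact (2 * Suc k)"
    unfolding Suc by (simp add: algebra_simps)
  finally show ?case .
qed simp

text \<open>Each factor is twice \<open>D + 1 + i\<close>, so the product is \<open>2 ^ k\<close>
  times the part of \<open>fact (D + k)\<close> above \<open>fact D\<close>.\<close>

lemma prod_even: "(\<Prod>i<k. real (2 * Suc D + 2 * i)) * fact D = 2 ^ k * fact (D + k)"
proof (induction k)
  case (Suc k)
  have "(\<Prod>i<Suc k. real (2 * Suc D + 2 * i)) * fact D =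
      real (2 * Suc D + 2 * k) * ((\<Prod>i<k. real (2 * Suc D + 2 * i)) * fact D)"
    by (simp only: prod.lessThan_Suc mult_ac)
  also have "\<dots> = 2 ^ Suc k * fact (D + Suc k)"
    unfolding Suc by (simp add: algebra_simps)
  finally show ?case .
qed simp

text \<open>The right-hand side is the middle term in the binomial expansion of the mean of
  \<open>(cinner z w + cnj (cinner z w)) ^ (2 * k)\<close>, the only term that survives.\<close>

lemma b_m_even:
  assumes "d \<ge> 1"
  shows "2 ^ (2 * k) * b_m d (2 * k) = real (2 * k choose k) * b_pq d k k"
proof -
  obtain D where D: "d = Suc D" using assms by (cases d) auto
  have odd: "(\<Prod>i<k. real (2 * i + 1)) = fact (2 * k) / (2 ^ k * fact k)"
    using prod_odd[of k] by (simp add: field_simps)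
  have even: "(\<Prod>i<k. real (2 * d + 2 * i)) = 2 ^ k * fact (D + k) / fact D"
    using prod_even[of D k] by (simp add: D field_simps)
  have "real (2 * k choose k) = fact (2 * k) / (fact k * fact k)"
    using binomial_fact[of k "2 * k", where 'a = real] by simp
  moreover have "b_m d (2 * k) = (fact (2 * k) / (2 ^ k * fact k)) / (2 ^ k * fact (D + k) / fact D)"
    unfolding odd[symmetric] even[symmetric] by (simp add: b_m_def)
  moreover have "b_pq d k k = fact D * fact k / fact (D + k)"
    by (simp add: b_pq_def D)
  ultimately show ?thesis
    by (simp add: mult_2 power_add)
qed

text \<open>Binomial expansion leaves powers with exponents \<open>j\<close> and
  \<open>m - j\<close>, whose mean vanishes unless these agree. That never happens for odd
  \<open>m\<close>, and only at the middle index for even \<open>m\<close>.\<close>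

lemma sphere_integral_b_m:
  fixes w :: "complex^'d"
  assumes "norm w = 1"
  shows "sphere_integral (\<lambda>z. (cinner z w + cnj (cinner z w)) ^ m) =
         complex_of_real (2 ^ m * b_m CARD('d) m)"
proof -
  let ?g = "\<lambda>j z. cinner z w ^ j * cnj (cinner z w) ^ (m - j)"
  let ?c = "\<lambda>j. complex_of_nat (m choose j)"
  have "sphere_integral (\<lambda>z. (cinner z w + cnj (cinner z w)) ^ m) = sphere_integral (\<lambda>z. \<Sum>j\<le>m. ?c j * ?g j z)"
    by (simp add: binomial_ring mult.assoc)
  also have "\<dots> = (\<Sum>j\<le>m. ?c j * sphere_integral (?g j))"
    by (intro sphere_integral_sum continuous_intros finite_atMost)
  also have "\<dots> = (\<Sum>j\<le>m. complex_of_real (real (m choose j) * b_pq CARD('d) j (m - j)))"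
    by (simp add: sphere_integral_b_pq[OF assms])
  also have "\<dots> = complex_of_real (2 ^ m * b_m CARD('d) m)"
  proof (cases "even m")
    case False
    then have "b_pq CARD('d) j (m - j) = 0" if "j \<le> m" for j
      using that by (auto simp: b_pq_def) (metis add_diff_inverse_nat even_add linorder_not_less)
    then show ?thesis using False by (simp add: b_m_def)
  next
    case True
    then obtain k where k: "m = 2 * k" by blast
    have "(\<Sum>j\<le>m. complex_of_real (real (m choose j) * b_pq CARD('d) j (m - j))) =
          (\<Sum>j\<le>m. if j = k then complex_of_real (real (m choose k) * b_pq CARD('d) k k) else 0)"
      by (intro sum.cong) (auto simp: k b_pq_def)
    also have "\<dots> = complex_of_real (real (m choose k) * b_pq CARD('d) k k)"
      by (simp add: k)
    also have "real (m choose k) * b_pq CARD('d) k k = 2 ^ m * b_m CARD('d) m"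
      using b_m_even[of "CARD('d)" k] by (simp add: k Suc_leI)
    finally show ?thesis .
  qed
  finally show ?thesis .
qed

subsection \<open>Potentials from reproducing kernels\<close>

text \<open>With \<open>L j = (\<Sum>k. w k * m j (v k))\<close> and \<open>e j = sphere_integral (m j)\<close>, the potential equals
  \<open>\<lambda> * (\<Sum>j. |L j - e j|\<^sup>2)\<close>: integrating the reproducing kernel in one variable gives the constant \<open>b\<close>,
  which evaluates both the cross terms and \<open>\<lambda> * (\<Sum>j. |e j|\<^sup>2)\<close>.\<close>

lemma gives_potential_kernel:
  fixes m :: "'j \<Rightarrow> complex^'d \<Rightarrow> complex" and mon :: "'a \<Rightarrow> complex^'d \<Rightarrow> complex"
    and lam b :: real
  assumes finJ: "finite J" and finA: "finite A" and img: "mon ` A = m ` J"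
    and m: "\<And>j. j \<in> J \<Longrightarrow> continuous_on UNIV (m j)"
    and lam: "lam > 0"
    and kernel: "\<And>z w :: complex^'d. F (cinner z w) = complex_of_real lam * (\<Sum>j\<in>J. m j z * cnj (m j w)) - complex_of_real b"
    and mean: "\<And>w :: complex^'d. norm w = 1 \<Longrightarrow> sphere_integral (\<lambda>z. F (cinner z w)) = 0"
  shows "gives_potential F {f. \<exists>c. \<forall>z. f z = (\<Sum>a\<in>A. c a * mon a z)}"
proof -
  define e where "e = (\<lambda>j. sphere_integral (m j))"
  let ?lam = "complex_of_real lam" and ?b = "complex_of_real b"
  have mon: "continuous_on UNIV (mon a)" if "a \<in> A" for a
    using img m that by (metis image_iff)
  \<comment> \<open>The hypothesis \<open>mean\<close> with the kernel expanded and integrated term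
    by term in the first variable.\<close>
  have mean_e: "?lam * (\<Sum>j\<in>J. cnj (m j w) * e j) = ?b" if "norm w = 1" for w
  proof -
    have K: "continuous_on UNIV (\<lambda>z. \<Sum>j\<in>J. cnj (m j w) * m j z)"
      by (intro continuous_intros m)
    have "0 = sphere_integral (\<lambda>z. ?lam * (\<Sum>j\<in>J. cnj (m j w) * m j z) + - ?b)"
      using mean[OF that] by (simp add: kernel mult.commute)
    also have "\<dots> = sphere_integral (\<lambda>z. ?lam * (\<Sum>j\<in>J. cnj (m j w) * m j z)) + - ?b"
      using K by (subst sphere_integral_add) (auto simp: sphere_integral_const intro: continuous_intros)
    also have "\<dots> = ?lam * (\<Sum>j\<in>J. cnj (m j w) * e j) + - ?b"
      using sphere_integral_cmult[OF K] sphere_integral_sum[OF finJ m, of "\<lambda>x. x" "\<lambda>j. cnj (m j w)"]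
      by (simp add: e_def)
    finally show ?thesis by simp
  qed
  \<comment> \<open>Averaging \<open>mean_e\<close> over \<open>w\<close> in the sphere.\<close>
  have ee: "?lam * (\<Sum>j\<in>J. e j * cnj (e j)) = ?b"
  proof -
    have "?b = sphere_integral (\<lambda>w::complex^'d. ?b)"
      by (simp add: sphere_integral_const)
    also have "\<dots> = sphere_integral (\<lambda>w. \<Sum>j\<in>J. (?lam * e j) * cnj (m j w))"
      by (rule sphere_integral_cong) (simp add: mean_e[symmetric] sum_distrib_left mult_ac)
    also have "\<dots> = (\<Sum>j\<in>J. (?lam * e j) * cnj (e j))"
      using m by (subst sphere_integral_sum) (auto simp: finJ sphere_integral_cnj e_def intro!: continuous_intros sum.cong)
    finally show ?thesis by (simp add: sum_distrib_left mult.assoc)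
  qed
  show ?thesis
    unfolding gives_potential_def
  proof (intro allI impI)
    fix n :: nat and v :: "nat \<Rightarrow> complex^'d" and w :: "nat \<Rightarrow> real"
    assume "(\<forall>j<n. norm (v j) = 1) \<and> (\<Sum>j<n. w j) = 1"
    then have v: "\<And>k. k < n \<Longrightarrow> norm (v k) = 1" and "(\<Sum>j<n. w j) = 1" by auto
    then have w: "(\<Sum>k<n. complex_of_real (w k)) = 1"
      by (simp flip: of_real_sum)
    define L where "L = (\<lambda>f::complex^'d \<Rightarrow> complex. \<Sum>k<n. complex_of_real (w k) * f (v k))"
    define S where "S = (\<Sum>k<n. \<Sum>l<n. complex_of_real (w k * w l) * F (cinner (v k) (v l)))"
    \<comment> \<open>The weighted sum of \<open>mean_e\<close> over the nodes \<open>v k\<close>,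
      with total weight 1.\<close>
    have Le: "?lam * (\<Sum>j\<in>J. cnj (L (m j)) * e j) = ?b"
    proof -
      have "?lam * (\<Sum>j\<in>J. cnj (L (m j)) * e j) =
          ?lam * (\<Sum>j\<in>J. \<Sum>k<n. complex_of_real (w k) * (cnj (m j (v k)) * e j))"
        by (simp add: L_def sum_distrib_right mult.assoc)
      also have "\<dots> = (\<Sum>k<n. complex_of_real (w k) * (?lam * (\<Sum>j\<in>J. cnj (m j (v k)) * e j)))"
        by (subst sum.swap) (simp add: sum_distrib_left mult_ac)
      also have "\<dots> = ?b"
        by (simp add: mean_e v w flip: sum_distrib_right)
      finally show ?thesis .
    qed
    have eL: "?lam * (\<Sum>j\<in>J. L (m j) * cnj (e j)) = ?b"
      using arg_cong[OF Le, of cnj] by simp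
    have "S = (\<Sum>k<n. \<Sum>l<n. ?lam * (\<Sum>j\<in>J. (complex_of_real (w k) * m j (v k)) * cnj (complex_of_real (w l) * m j (v l))))
          - (\<Sum>k<n. \<Sum>l<n. complex_of_real (w k) * complex_of_real (w l) * ?b)"
      by (simp add: S_def kernel right_diff_distrib sum_subtractf sum_distrib_left mult_ac)
    also have "(\<Sum>k<n. \<Sum>l<n. complex_of_real (w k) * complex_of_real (w l) * ?b) = ?b"
      by (simp add: w flip: sum_distrib_right sum_distrib_left)
    also have "(\<Sum>k<n. \<Sum>l<n. ?lam * (\<Sum>j\<in>J. (complex_of_real (w k) * m j (v k)) * cnj (complex_of_real (w l) * m j (v l))))
        = ?lam * (\<Sum>j\<in>J. L (m j) * cnj (L (m j)))"
      unfolding L_def cnj_sum sum_product sum_distrib_left[symmetric]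
      by (subst sum.swap[of _ J], subst sum.swap[of _ J]) (simp only: sum_distrib_left)
    finally have S: "S = ?lam * (\<Sum>j\<in>J. L (m j) * cnj (L (m j))) - ?b" .
    \<comment> \<open>Completing the square: the two cross terms contribute \<open>-b\<close> each
      and the last square contributes \<open>b\<close>.\<close>
    also have "\<dots> = ?lam * (\<Sum>j\<in>J. (L (m j) - e j) * cnj (L (m j) - e j))"
      using Le eL ee by (simp add: algebra_simps sum.distrib sum_subtractf)
    finally have S: "S = complex_of_real (lam * (\<Sum>j\<in>J. (norm (L (m j) - e j))\<^sup>2))"
      by (simp only: complex_norm_square[symmetric] of_real_mult of_real_sum)
    have "S = 0 \<longleftrightarrow> (\<forall>j\<in>J. e j = L (m j))"
      using lam finJ by (auto simp: S sum_nonneg_eq_0_iff simp del: of_real_mult of_real_sum)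
    also have "\<dots> \<longleftrightarrow> (\<forall>f\<in>m ` J. sphere_integral f = L f)"
      by (simp add: e_def)
    \<comment> \<open>Exactness depends only on which functions occur, so \<open>img\<close>
      replaces the family with repetitions by the monomials \<open>mon\<close>.\<close>
    also have "\<dots> \<longleftrightarrow> (\<forall>a\<in>A. sphere_integral (mon a) = L (mon a))"
      by (simp flip: img)
    also have "\<dots> \<longleftrightarrow> (\<forall>f\<in>{f. \<exists>c. \<forall>z. f z = (\<Sum>a\<in>A. c a * mon a z)}. sphere_integral f = L f)"
    proof safe
      fix f c
      assume exact: "\<forall>a\<in>A. sphere_integral (mon a) = L (mon a)" and "\<forall>z. f z = (\<Sum>a\<in>A. c a * mon a z)"
      then have f: "f = (\<lambda>z. \<Sum>a\<in>A. c a * mon a z)" by blast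
      have "sphere_integral f = (\<Sum>a\<in>A. c a * L (mon a))"
        unfolding f using exact by (subst sphere_integral_sum) (auto simp: finA mon)
      also have "\<dots> = L f"
        unfolding L_def f by (simp add: sum_distrib_left mult_ac) (rule sum.swap)
      finally show "sphere_integral f = L f" .
    next
      fix a
      assume all: "\<forall>f\<in>{f. \<exists>c. \<forall>z. f z = (\<Sum>a\<in>A. c a * mon a z)}. sphere_integral f = L f" and a: "a \<in> A"
      have "\<forall>z. mon a z = (\<Sum>a'\<in>A. of_bool (a' = a) * mon a' z)"
        using a finA by (simp add: of_bool_def if_distrib[of "\<lambda>x. x * _"] cong: if_cong)
      then have "mon a \<in> {f. \<exists>c. \<forall>z. f z = (\<Sum>a\<in>A. c a * mon a z)}"
        by (intro CollectI exI[of _ "\<lambda>a'. of_bool (a' = a)"])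
      then show "sphere_integral (mon a) = L (mon a)" using all by simp
    qed
    finally have "S = 0 \<longleftrightarrow> (\<forall>f\<in>{f. \<exists>c. \<forall>z. f z = (\<Sum>a\<in>A. c a * mon a z)}. sphere_integral f = L f)" .
    moreover have "S \<in> \<real>" "Re S \<ge> 0"
      using lam by (simp_all add: S sum_nonneg del: of_real_mult of_real_sum)
    ultimately show "let S = (\<Sum>j<n. \<Sum>k<n. complex_of_real (w j * w k) * F (cinner (v j) (v k))) in
          S \<in> \<real> \<and> Re S \<ge> 0 \<and>
          (S = 0 \<longleftrightarrow> (\<forall>f\<in>{f. \<exists>c. \<forall>z. f z = (\<Sum>a\<in>A. c a * mon a z)}.
            sphere_integral f = (\<Sum>j<n. complex_of_real (w j) * f (v j))))"
      unfolding Let_def S_def[symmetric] L_def by blast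
  qed
qed

subsection \<open>Monomials indexed by lists of coordinates\<close>

text \<open>Multiplying out without collecting equal terms gives one product per list of chosen
  indices, so that all coefficients in the kernel expansions are equal.\<close>

lemma sum_power_lists:
  fixes a :: "'i::finite \<Rightarrow> 'b::comm_semiring_1"
  shows "sum a UNIV ^ p = (\<Sum>xs | length xs = p. prod_list (map a xs))"
proof (induction p)
  case (Suc p)
  have eq: "{xs::'i list. length xs = Suc p} = (\<lambda>(x, xs). x # xs) ` (UNIV \<times> {xs. length xs = p})"
    by (auto simp: length_Suc_conv)
  have "(\<Sum>xs | length xs = Suc p. prod_list (map a xs)) = (\<Sum>(x, xs)\<in>UNIV \<times> {xs. length xs = p}. a x * prod_list (map a xs))"
    unfolding eq by (subst sum.reindex) (auto simp: inj_on_def split_def)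
  also have "\<dots> = sum a UNIV ^ Suc p"
    by (simp add: Suc sum_product sum.cartesian_product)
  finally show ?case by simp
qed simp

lemma prod_list_count:
  fixes a :: "'i::finite \<Rightarrow> 'b::comm_semiring_1"
  shows "prod_list (map a xs) = (\<Prod>i\<in>UNIV. a i ^ count_list xs i)"
proof (induction xs)
  case (Cons x xs)
  have "(\<Prod>i\<in>UNIV. a i ^ count_list (x # xs) i) = (\<Prod>i\<in>UNIV. (if i = x then a i else 1) * a i ^ count_list xs i)"
    by (intro prod.cong) auto
  also have "\<dots> = a x * prod_list (map a xs)"
    by (simp add: prod.distrib Cons)
  finally show ?case by simp
qed simp

text \<open>Surjectivity is by induction on the total degree: lower a nonzero exponent by one and
  put its index in front of the list. This also yields finiteness of the exponent sets.\<close>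

lemma image_count_list:
  "count_list ` {xs::'i::finite list. length xs = p} = {\<alpha>. sum \<alpha> UNIV = p}"
proof safe
  fix xs :: "'i list"
  show "sum (count_list xs) UNIV = length xs"
    by (simp add: sum_count_set)
next
  fix \<alpha> :: "'i \<Rightarrow> nat"
  show "\<alpha> \<in> count_list ` {xs. length xs = sum \<alpha> UNIV}"
  proof (induction "sum \<alpha> UNIV" arbitrary: \<alpha>)
    case 0
    then show ?case by (auto simp: fun_eq_iff image_iff)
  next
    case (Suc p)
    then obtain i where i: "\<alpha> i \<noteq> 0" by fastforce
    define \<beta> where "\<beta> = \<alpha>(i := \<alpha> i - 1)"
    have \<alpha>: "\<alpha> = (\<lambda>j. (if j = i then 1 else 0) + \<beta> j)"
      using i by (auto simp: \<beta>_def)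
    have sum: "sum \<alpha> UNIV = Suc (sum \<beta> UNIV)"
      by (simp add: \<alpha> sum.distrib)
    then have "p = sum \<beta> UNIV" using Suc.hyps(2) by simp
    from Suc.hyps(1)[OF this] obtain xs where xs: "length xs = sum \<beta> UNIV" "\<beta> = count_list xs"
      by blast
    have "\<alpha> = count_list (i # xs)"
      unfolding \<alpha> xs(2) by (simp add: fun_eq_iff)
    then show ?case
      using xs(1) sum by (intro image_eqI[of _ _ "i # xs"]) auto
  qed
qed

lemma finite_lists_length: "finite {xs::'i::finite list. length xs = p}"
  using finite_lists_length_eq[of "UNIV :: 'i set" p] by simp

lemma finite_exponents: "finite {\<alpha>::'i::finite \<Rightarrow> nat. sum \<alpha> UNIV = p}"
  unfolding image_count_list[symmetric] by (intro finite_imageI finite_lists_length)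

lemma continuous_on_prod_list [continuous_intros]:
  fixes f :: "'i \<Rightarrow> 'a::topological_space \<Rightarrow> complex"
  assumes "\<And>i. continuous_on S (f i)"
  shows "continuous_on S (\<lambda>z. prod_list (map (\<lambda>i. f i z) xs))"
  by (induction xs) (auto intro: continuous_intros assms)

lemma cnj_prod_list: "cnj (prod_list xs) = prod_list (map cnj xs)"
  by (induction xs) auto

lemma prod_list_map_mult:
  fixes f g :: "'i \<Rightarrow> 'b::comm_monoid_mult"
  shows "prod_list (map (\<lambda>i. f i * g i) xs) = prod_list (map f xs) * prod_list (map g xs)"
  by (induction xs) (auto simp: mult_ac)

section \<open>The potentials for the two polynomial spaces\<close>

lemma gives_potential_Hom_pq:
  "gives_potential (\<lambda>z. z ^ p * cnj z ^ q - complex_of_real (b_pq CARD('d) p q))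
     (Hom_pq p q :: (complex^'d \<Rightarrow> complex) set)"
proof -
  define F where "F = (\<lambda>z. z ^ p * cnj z ^ q - complex_of_real (b_pq CARD('d) p q))"
  define X where "X = (\<lambda>(z::complex^'d) xs. prod_list (map (\<lambda>i. z $ i) xs))"
  define m where "m = (\<lambda>(xs, ys) z. X z xs * cnj (X z ys))"
  define mon where "mon = (\<lambda>(\<alpha>, \<beta>) (z::complex^'d). \<Prod>i\<in>UNIV. (z$i) ^ (\<alpha> i :: nat) * (cnj (z$i)) ^ (\<beta> i :: nat))"
  let ?J = "{xs::'d list. length xs = p} \<times> {ys::'d list. length ys = q}"
  let ?A = "{\<alpha>::'d \<Rightarrow> nat. sum \<alpha> UNIV = p} \<times> {\<beta>::'d \<Rightarrow> nat. sum \<beta> UNIV = q}"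
  have mon_count: "mon (count_list xs, count_list ys) = m (xs, ys)" for xs ys
    by (simp add: mon_def m_def X_def prod_list_count prod.distrib fun_eq_iff)
  have "?A = (\<lambda>(xs, ys). (count_list xs, count_list ys)) ` ?J"
    unfolding image_count_list[symmetric] by (auto simp: image_iff)
  then have img: "mon ` ?A = m ` ?J"
    by (simp only: image_image) (intro image_cong; auto simp: mon_count)
  have cont: "continuous_on UNIV (m j)" for j
    unfolding m_def X_def split_def by (intro continuous_intros)
  \<comment> \<open>Both powers are expanded over lists. The second is conjugated, which is why
    \<open>m\<close> contains the product over \<open>ys\<close> conjugated; here
    \<open>lam = 1\<close>.\<close>
  have kernel: "F (cinner z w) = complex_of_real 1 * (\<Sum>j\<in>?J. m j z * cnj (m j w)) - complex_of_real (b_pq CARD('d) p q)"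
    for z w :: "complex^'d"
  proof -
    have pow: "cinner z w ^ r = (\<Sum>xs | length xs = r. X z xs * cnj (X w xs))" for r and z w :: "complex^'d"
      by (simp add: cinner_def sum_power_lists prod_list_map_mult X_def cnj_prod_list comp_def)
    have "cinner z w ^ p * cnj (cinner z w) ^ q = (\<Sum>j\<in>?J. m j z * cnj (m j w))"
      unfolding complex_cnj_power[symmetric] pow cnj_sum sum_product sum.cartesian_product
      by (simp add: m_def split_def mult_ac)
    then show ?thesis by (simp add: F_def)
  qed
  have mean: "sphere_integral (\<lambda>z. F (cinner z w)) = 0" if "norm w = 1" for w :: "complex^'d"
    using sphere_integral_add[of "\<lambda>z. cinner z w ^ p * cnj (cinner z w) ^ q" "\<lambda>_. - complex_of_real (b_pq CARD('d) p q)"]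
    by (simp add: F_def sphere_integral_b_pq[OF that] sphere_integral_const continuous_intros)
  have Hom: "(Hom_pq p q :: (complex^'d \<Rightarrow> complex) set) = {f. \<exists>c. \<forall>z. f z = (\<Sum>a\<in>?A. c a * mon a z)}"
  proof (intro equalityI subsetI CollectI)
    fix f :: "complex^'d \<Rightarrow> complex"
    assume "f \<in> Hom_pq p q"
    then obtain c where "\<forall>z. f z = (\<Sum>\<alpha> | sum \<alpha> UNIV = p. \<Sum>\<beta> | sum \<beta> UNIV = q. c \<alpha> \<beta> * mon (\<alpha>, \<beta>) z)"
      unfolding Hom_pq_def mon_def by auto
    then show "\<exists>c. \<forall>z. f z = (\<Sum>a\<in>?A. c a * mon a z)"
      by (intro exI[of _ "case_prod c"]) (simp add: sum.cartesian_product split_def)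
  next
    fix f :: "complex^'d \<Rightarrow> complex"
    assume "f \<in> {f. \<exists>c. \<forall>z. f z = (\<Sum>a\<in>?A. c a * mon a z)}"
    then obtain c where "\<forall>z. f z = (\<Sum>a\<in>?A. c a * mon a z)" by auto
    then have "\<forall>z. f z = (\<Sum>\<alpha> | sum \<alpha> UNIV = p. \<Sum>\<beta> | sum \<beta> UNIV = q. c (\<alpha>, \<beta>) * mon (\<alpha>, \<beta>) z)"
      by (simp add: sum.cartesian_product split_def)
    then show "f \<in> Hom_pq p q"
      unfolding Hom_pq_def mon_def by (auto intro!: exI[of _ "curry c"])
  qed
  show ?thesis
    unfolding F_def[symmetric] Hom
    by (rule gives_potential_kernel[where J = ?J and m = m, OF _ _ img _ _ kernel mean])
       (auto intro: finite_lists_length finite_exponents cont)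
qed

text \<open>The real part of \<open>cinner\<close> is the Euclidean inner product of the real
  coordinates, so the kernel is \<open>2 ^ m\<close> times its \<open>m\<close>-th power, expanded
  over lists of real coordinates.\<close>

lemma gives_potential_Hom_m:
  "gives_potential (\<lambda>z. (z + cnj z) ^ m - 2 ^ m * complex_of_real (b_m CARD('d) m))
     (Hom_m m :: (complex^'d \<Rightarrow> complex) set)"
proof -
  define b where "b = 2 ^ m * b_m CARD('d) m"
  define F where "F = (\<lambda>z. (z + cnj z) ^ m - complex_of_real b)"
  \<comment> \<open>The sum type indexes the real coordinates: \<open>Inl\<close> for real parts,
    \<open>Inr\<close> for imaginary parts.\<close>
  define x where "x = (\<lambda>(z::complex^'d). case_sum (\<lambda>i. Re (z $ i)) (\<lambda>i. Im (z $ i)))"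
  define X where "X = (\<lambda>xs (z::complex^'d). prod_list (map (\<lambda>i. complex_of_real (x z i)) xs))"
  define mon where "mon = (\<lambda>\<alpha>\<beta> (z::complex^'d).
     \<Prod>i\<in>UNIV. complex_of_real ((Re (z$i)) ^ (fst \<alpha>\<beta> i :: nat) * (Im (z$i)) ^ (snd \<alpha>\<beta> i :: nat)))"
  let ?J = "{xs::('d + 'd) list. length xs = m}"
  let ?A = "{(\<alpha>, \<beta>). sum \<alpha> (UNIV::'d set) + sum \<beta> (UNIV::'d set) = m}"
  have sumU: "sum f (UNIV::('d + 'd) set) = (\<Sum>i\<in>UNIV. f (Inl i)) + (\<Sum>i\<in>UNIV. f (Inr i))"
    for f :: "_ \<Rightarrow> 'b::comm_monoid_add"
    unfolding UNIV_Plus_UNIV[symmetric] by (subst sum.Plus) auto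
  have prodU: "prod f (UNIV::('d + 'd) set) = (\<Prod>i\<in>UNIV. f (Inl i)) * (\<Prod>i\<in>UNIV. f (Inr i))"
    for f :: "_ \<Rightarrow> 'b::comm_monoid_mult"
    unfolding UNIV_Plus_UNIV[symmetric] by (subst prod.Plus) auto
  \<comment> \<open>An exponent function on the sum type amounts to a pair of exponent functions on
    \<open>'d\<close>, which carries \<open>image_count_list\<close> over to
    \<open>Hom_m\<close>.\<close>
  define split where "split = (\<lambda>\<gamma>::'d + 'd \<Rightarrow> nat. (\<gamma> \<circ> Inl, \<gamma> \<circ> Inr))"
  have A: "?A = split ` {\<gamma>. sum \<gamma> UNIV = m}"
  proof (intro equalityI subsetI)
    fix ab :: "('d \<Rightarrow> nat) \<times> ('d \<Rightarrow> nat)"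
    assume "ab \<in> ?A"
    then show "ab \<in> split ` {\<gamma>. sum \<gamma> UNIV = m}"
      by (intro image_eqI[of _ _ "case_sum (fst ab) (snd ab)"]) (auto simp: split_def sumU comp_def)
  qed (auto simp: split_def sumU)
  have "mon (split (count_list xs)) = X xs" for xs
    by (simp add: mon_def split_def X_def prod_list_count prodU x_def prod.distrib fun_eq_iff)
  then have img: "mon ` ?A = X ` ?J"
    unfolding A image_count_list[symmetric] by (simp add: image_image)
  have cont: "continuous_on UNIV (X xs)" for xs
  proof -
    have "continuous_on UNIV (\<lambda>z. complex_of_real (x z i))" for i
      by (cases i) (auto simp: x_def intro!: continuous_intros)
    then show ?thesis unfolding X_def by (rule continuous_on_prod_list)
  qed
  have kernel: "F (cinner z w) = complex_of_real (2 ^ m) * (\<Sum>xs\<in>?J. X xs z * cnj (X xs w)) - complex_of_real b"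
    for z w :: "complex^'d"
  proof -
    have "cinner z w + cnj (cinner z w) = 2 * (\<Sum>i\<in>UNIV. complex_of_real (x z i) * complex_of_real (x w i))"
      unfolding sumU x_def cinner_def
      by (simp add: sum_distrib_left complex_eq_iff flip: sum.distrib) (simp add: algebra_simps)
    then show ?thesis
      by (simp add: F_def power_mult_distrib sum_power_lists prod_list_map_mult X_def cnj_prod_list comp_def)
  qed
  have mean: "sphere_integral (\<lambda>z. F (cinner z w)) = 0" if "norm w = 1" for w :: "complex^'d"
    using sphere_integral_add[of "\<lambda>z. (cinner z w + cnj (cinner z w)) ^ m" "\<lambda>_. - complex_of_real b"]
    by (simp add: F_def b_def sphere_integral_b_m[OF that] sphere_integral_const continuous_intros)
  have Hom: "(Hom_m m :: (complex^'d \<Rightarrow> complex) set) = {f. \<exists>c. \<forall>z. f z = (\<Sum>a\<in>?A. c a * mon a z)}"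
  proof (intro equalityI subsetI CollectI)
    fix f :: "complex^'d \<Rightarrow> complex"
    assume "f \<in> Hom_m m"
    then obtain c where "\<forall>z. f z = (\<Sum>a\<in>?A. c (fst a) (snd a) * mon a z)"
      unfolding Hom_m_def mon_def by auto
    then show "\<exists>c. \<forall>z. f z = (\<Sum>a\<in>?A. c a * mon a z)"
      by (intro exI[of _ "\<lambda>a. c (fst a) (snd a)"])
  next
    fix f :: "complex^'d \<Rightarrow> complex"
    assume "f \<in> {f. \<exists>c. \<forall>z. f z = (\<Sum>a\<in>?A. c a * mon a z)}"
    then obtain c where "\<forall>z. f z = (\<Sum>a\<in>?A. c a * mon a z)" by auto
    then show "f \<in> Hom_m m"
      unfolding Hom_m_def mon_def by (auto intro!: exI[of _ "curry c"])
  qed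
  have F: "(\<lambda>z. (z + cnj z) ^ m - 2 ^ m * complex_of_real (b_m CARD('d) m)) = F"
    by (simp add: F_def b_def)
  have "finite ?A"
    unfolding A by (intro finite_imageI finite_exponents)
  then show ?thesis
    unfolding F Hom
    by (intro gives_potential_kernel[where J = ?J and m = X, OF _ _ img _ _ kernel mean])
       (auto intro: finite_lists_length cont)
qed

theorem theorem5p7:
  shows "(\<forall>p q. gives_potential
            (\<lambda>z. z ^ p * cnj z ^ q - complex_of_real (b_pq CARD('d) p q))
            (Hom_pq p q :: (complex^'d \<Rightarrow> complex) set))
       \<and> (\<forall>m\<ge>1. (\<forall>z. (z + cnj z) ^ m - 2 ^ m * complex_of_real (b_m CARD('d) m)
                     = 2 ^ m * complex_of_real (Re z ^ m - b_m CARD('d) m))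
              \<and> gives_potential
                 (\<lambda>z. (z + cnj z) ^ m - 2 ^ m * complex_of_real (b_m CARD('d) m))
                 (Hom_m m :: (complex^'d \<Rightarrow> complex) set))"
proof (intro conjI allI impI gives_potential_Hom_pq gives_potential_Hom_m)
  fix m :: nat and z :: complex
  show "(z + cnj z) ^ m - 2 ^ m * complex_of_real (b_m CARD('d) m)
      = 2 ^ m * complex_of_real (Re z ^ m - b_m CARD('d) m)"
    by (simp add: complex_add_cnj power_mult_distrib right_diff_distrib)
qed

end
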